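(* Let $N,K,d,a_m$ be positive integers with $d$ dividing $N$, and let $\hat{x}\in\mathbb{C}^N$ be generally $K$-sparse with significant index set $T$ ($|T|=K$). Let $\epsilon_{min}=\min_{j\in T}|\hat{x}[j]|$ and $q_{max}=\max_{j\notin T}|\hat{x}[j]|$. Suppose $\epsilon_{min}>2dq_{max}$ and that every bin $S_k$ contains at most one significant index (i.e. $a_k:=|S_k\cap T|\le 1$ for all $k$). Then the collision-counting step of sFFT-DT determines the number of collisions correctly, i.e. $\tilde{a}_k=a_k$ for every $k\in\{0,\dots,N/d-1\}$.
   Context: Bins: $S_k=\{k+jN/d:0\le j\le d-1\}$ for $k\in\{0,\dots,N/d-1\}$. Generally $K$-sparse: all entries may be nonzero; the significant entries are the $K$ entries of largest magnitude. For bin $k$ define the syndromes $m_i(k)=\sum_{j\in S_k}\hat{x}[j]e^{i2\pi ji/N}$ ($0\le i\le 2a_m-2$; these are obtained, up to a known constant, from FFTs of the downsampled signals $x[dn+i]$) and the Hankel matrix $M^{(k)}\in\mathbb{C}^{a_m\times a_m}$, $M^{(k)}_{i,j}=m_{i+j}(k)$. Collision-counting step: compute all $a_m$ singular values of every $M^{(k)}$, each labeled by its bin $k$; select the $K$ largest among all $\frac{N}{d}a_m$ singular values; the estimated number of collisions $\tilde{a}_k$ of bin $k$ is the number of selected singular values labeled $k$. *)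

theory Defs
  imports
    "Jordan_Normal_Form.Schur_Decomposition"
    "HOL-Computational_Algebra.Fundamental_Theorem_Algebra"
begin

(* R consists of K elements of A with the largest f-values; with ties there are several such R. *)
definition largest_subset :: "('a \<Rightarrow> real) \<Rightarrow> nat \<Rightarrow> 'a set \<Rightarrow> 'a set \<Rightarrow> bool" where
  "largest_subset f K A R \<longleftrightarrow>
     R \<subseteq> A \<and> card R = K \<and> (\<forall>p\<in>R. \<forall>q\<in>A - R. f q \<le> f p)"

definition significant_set :: "complex vec \<Rightarrow> nat \<Rightarrow> nat set \<Rightarrow> bool" where
  "significant_set x K T \<longleftrightarrow> largest_subset (\<lambda>j. cmod (x $ j)) K {..<dim_vec x} T"

definition eps_min :: "complex vec \<Rightarrow> nat set \<Rightarrow> real" where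
  "eps_min x T = Min ((\<lambda>j. cmod (x $ j)) ` T)"

(* If every index is significant, the maximum over the empty set of magnitudes is read as 0. *)
definition q_max :: "complex vec \<Rightarrow> nat set \<Rightarrow> real" where
  "q_max x T =
     (if {..<dim_vec x} - T = {} then 0
      else Max ((\<lambda>j. cmod (x $ j)) ` ({..<dim_vec x} - T)))"

definition bin :: "nat \<Rightarrow> nat \<Rightarrow> nat \<Rightarrow> nat set" where
  "bin N d k = {k + j * (N div d) | j. j < d}"

definition syndrome :: "complex vec \<Rightarrow> nat \<Rightarrow> nat \<Rightarrow> nat \<Rightarrow> complex" where
  "syndrome x d k i =
     (\<Sum>j\<in>bin (dim_vec x) d k.
        x $ j * exp (\<i> * complex_of_real (2 * pi * real j * real i / real (dim_vec x))))"

definition hankel :: "complex vec \<Rightarrow> nat \<Rightarrow> nat \<Rightarrow> nat \<Rightarrow> complex mat" where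
  "hankel x d am k = mat am am (\<lambda>(i, j). syndrome x d k (i + j))"

(* Singular values of M, in decreasing order with multiplicity: the square roots of the
   eigenvalues of the positive semidefinite matrix M^* M. *)
definition singular_values :: "complex mat \<Rightarrow> real list" where
  "singular_values M =
     rev (sorted_list_of_multiset
       (image_mset (\<lambda>e. sqrt (Re e)) (proots (char_poly (mat_adjoint M * M)))))"

lemma length_singular_values:
  assumes "M \<in> carrier_mat n n"
  shows "length (singular_values M) = n"
proof -
  have "mat_adjoint M * M \<in> carrier_mat n n"
    using assms by (auto simp: mat_adjoint_def)
  then have "degree (char_poly (mat_adjoint M * M)) = n"
    by (simp add: degree_monic_char_poly)
  moreover have "length (sorted_list_of_multiset A) = size A" for A :: "real multiset"
    by (metis mset_sorted_list_of_multiset size_mset)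
  ultimately show ?thesis
    by (simp add: singular_values_def size_proots_complex)
qed

(* The pair (k, l) labels the l-th singular value of the Hankel matrix of bin k. *)
definition labeled_singular_value :: "complex vec \<Rightarrow> nat \<Rightarrow> nat \<Rightarrow> nat \<times> nat \<Rightarrow> real" where
  "labeled_singular_value x d am = (\<lambda>(k, l). singular_values (hankel x d am k) ! l)"

definition selection :: "complex vec \<Rightarrow> nat \<Rightarrow> nat \<Rightarrow> nat \<Rightarrow> (nat \<times> nat) set \<Rightarrow> bool" where
  "selection x d am K R \<longleftrightarrow>
     largest_subset (labeled_singular_value x d am) K ({..<dim_vec x div d} \<times> {..<am}) R"

definition estimated_collisions :: "(nat \<times> nat) set \<Rightarrow> nat \<Rightarrow> nat" where
  "estimated_collisions R k = card {p \<in> R. fst p = k}"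

end

theory Submission
  imports Defs "Jordan_Normal_Form.Spectral_Radius" "HOL-Analysis.L2_Norm"
begin

text \<open>
  With \<open>v\<^sub>j = (exp (2\<pi>\<i>jl/N))\<^sub>l\<close> the Hankel matrix of a bin is the sum of the rank-one matrices
  \<open>x\<^sub>j v\<^sub>j v\<^sub>j\<^sup>T\<close> over the bin, each of operator norm \<open>a\<^sub>m |x\<^sub>j|\<close>. Hence all singular values of a bin
  without significant index are at most \<open>\<tau> = a\<^sub>m d q\<^sub>m\<^sub>a\<^sub>x\<close>. In a bin with one significant index \<open>t\<close>,
  testing on the conjugate of \<open>v\<^sub>t\<close> shows that the largest singular value is at least
  \<open>a\<^sub>m (|x\<^sub>t| - d q\<^sub>m\<^sub>a\<^sub>x) > \<tau>\<close>, while the bound \<open>\<tau>\<close> on the hyperplane \<open>v\<^sub>t\<^sup>T u = 0\<close> forces every other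
  singular value to be at most \<open>\<tau>\<close>. So exactly \<open>K\<close> singular values exceed \<open>\<tau>\<close>, one for each
  occupied bin, and these are the ones selected.
\<close>

section \<open>Euclidean norm of complex vectors\<close>

text \<open>Going through the real vector of moduli lets the triangle and Cauchy-Schwarz
  inequalities of \<open>L2_set\<close> carry over.\<close>

definition norm2 :: "complex vec \<Rightarrow> real" where
  "norm2 v = L2_set (\<lambda>i. cmod (v $ i)) {..<dim_vec v}"

lemma norm2_nonneg [simp]: "0 \<le> norm2 v"
  by (simp add: norm2_def)

lemma norm2_eq_0_iff:
  assumes "v \<in> carrier_vec n"
  shows "norm2 v = 0 \<longleftrightarrow> v = 0\<^sub>v n"
  using assms by (auto simp: norm2_def L2_set_eq_0_iff)

lemma norm2_smult: "norm2 (c \<cdot>\<^sub>v v) = cmod c * norm2 v"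
proof -
  have "norm2 (c \<cdot>\<^sub>v v) = L2_set (\<lambda>i. cmod c * cmod (v $ i)) {..<dim_vec v}"
    unfolding norm2_def by (intro L2_set_cong) (auto simp: norm_mult)
  then show ?thesis by (simp add: norm2_def L2_set_right_distrib)
qed

lemma norm2_conjugate [simp]: "norm2 (conjugate v) = norm2 v"
  unfolding norm2_def by (intro L2_set_cong) auto

lemma norm2_triangle:
  assumes "dim_vec u = dim_vec v"
  shows "norm2 (u + v) \<le> norm2 u + norm2 v"
proof -
  have "norm2 (u + v) \<le> L2_set (\<lambda>i. cmod (u $ i) + cmod (v $ i)) {..<dim_vec v}"
    unfolding norm2_def by (auto intro!: L2_set_mono norm_triangle_ineq)
  also have "\<dots> \<le> norm2 u + norm2 v"
    using assms L2_set_triangle_ineq unfolding norm2_def by metis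
  finally show ?thesis .
qed

lemma norm2_sum_le:
  assumes "finite S"
  shows "norm2 (vec n (\<lambda>i. \<Sum>j\<in>S. f j i)) \<le> (\<Sum>j\<in>S. norm2 (vec n (f j)))"
  using assms
proof (induction S rule: finite_induct)
  case empty
  show ?case by (simp add: norm2_def L2_set_0')
next
  case (insert a S)
  have "vec n (\<lambda>i. \<Sum>j\<in>insert a S. f j i) = vec n (f a) + vec n (\<lambda>i. \<Sum>j\<in>S. f j i)"
    using insert.hyps by auto
  with insert norm2_triangle[of "vec n (f a)" "vec n (\<lambda>i. \<Sum>j\<in>S. f j i)"]
  show ?case by simp
qed

lemma norm2_Cauchy_Schwarz:
  assumes "dim_vec u = dim_vec v"
  shows "cmod (u \<bullet> v) \<le> norm2 u * norm2 v"
proof -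
  have "cmod (u \<bullet> v) \<le> (\<Sum>i<dim_vec v. \<bar>cmod (u $ i)\<bar> * \<bar>cmod (v $ i)\<bar>)"
    unfolding scalar_prod_def atLeast0LessThan
    by (rule order_trans[OF norm_sum]) (simp add: norm_mult)
  also have "\<dots> \<le> norm2 u * norm2 v"
    using assms L2_set_mult_ineq unfolding norm2_def by metis
  finally show ?thesis .
qed

lemma cscalar_prod_self: "v \<bullet>c v = complex_of_real ((norm2 v)\<^sup>2)"
  by (simp add: norm2_def L2_set_def sum_nonneg scalar_prod_def atLeast0LessThan
      complex_norm_square del: of_real_power)

section \<open>Adjoints and Gram matrices\<close>

lemma mat_adjoint_carrier:
  fixes M :: "complex mat"
  assumes "M \<in> carrier_mat n n"
  shows "mat_adjoint M \<in> carrier_mat n n"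
  using assms by (auto simp: mat_adjoint_def)

lemma mat_adjoint_index:
  fixes M :: "complex mat"
  assumes "M \<in> carrier_mat n n" "i < n" "j < n"
  shows "mat_adjoint M $$ (i, j) = cnj (M $$ (j, i))"
  using assms by (simp add: mat_adjoint_def mat_of_rows_def)

lemma mat_adjoint_adjoint:
  fixes M :: "complex mat"
  assumes "M \<in> carrier_mat n n"
  shows "mat_adjoint (mat_adjoint M) = M"
  using assms mat_adjoint_carrier[OF assms] mat_adjoint_carrier[OF mat_adjoint_carrier[OF assms]]
  by (intro eq_matI) (auto simp: mat_adjoint_index[of _ n])

lemma cscalar_prod_adjoint:
  fixes M :: "complex mat"
  assumes "M \<in> carrier_mat n n" "u \<in> carrier_vec n" "v \<in> carrier_vec n"
  shows "(M *\<^sub>v u) \<bullet>c v = u \<bullet>c (mat_adjoint M *\<^sub>v v)"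
proof -
  have "(M *\<^sub>v u) \<bullet>c v = (\<Sum>i<n. \<Sum>j<n. M $$ (i, j) * u $ j * cnj (v $ i))"
    using assms by (simp add: scalar_prod_def atLeast0LessThan sum_distrib_right)
  also have "\<dots> = (\<Sum>j<n. \<Sum>i<n. M $$ (i, j) * u $ j * cnj (v $ i))"
    by (rule sum.swap)
  also have "\<dots> = u \<bullet>c (mat_adjoint M *\<^sub>v v)"
    using assms mat_adjoint_carrier[OF assms(1)]
    by (simp add: scalar_prod_def atLeast0LessThan sum_distrib_left mat_adjoint_index[of _ n]
        mult_ac)
  finally show ?thesis .
qed

lemma gram_carrier:
  fixes M :: "complex mat"
  assumes "M \<in> carrier_mat n n"
  shows "mat_adjoint M * M \<in> carrier_mat n n"
  using mult_carrier_mat[OF mat_adjoint_carrier[OF assms] assms] .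

text \<open>For \<open>u = v\<close> the right-hand side is the squared norm of
  \<open>M *\<^sub>v v\<close>; this ties eigenvalues of the Gram matrix to norms.\<close>

lemma cscalar_prod_gram:
  fixes M :: "complex mat"
  assumes "M \<in> carrier_mat n n" "u \<in> carrier_vec n" "v \<in> carrier_vec n"
  shows "((mat_adjoint M * M) *\<^sub>v u) \<bullet>c v = (M *\<^sub>v u) \<bullet>c (M *\<^sub>v v)"
proof -
  have "((mat_adjoint M * M) *\<^sub>v u) \<bullet>c v = (mat_adjoint M *\<^sub>v (M *\<^sub>v u)) \<bullet>c v"
    using assms mat_adjoint_carrier[OF assms(1)] by (simp add: assoc_mult_mat_vec[of _ n n _ n])
  also have "\<dots> = (M *\<^sub>v u) \<bullet>c (M *\<^sub>v v)"
    using cscalar_prod_adjoint[of "mat_adjoint M" n "M *\<^sub>v u" v] assms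
      mat_adjoint_carrier[OF assms(1)] mat_adjoint_adjoint[OF assms(1)] by auto
  finally show ?thesis .
qed

section \<open>Powers of Hermitian matrices\<close>

text \<open>Matrix powers are defined with the new factor on the right; moving it to the left gives
  the one-step recursion of the iterates.\<close>

lemma pow_mat_Suc_mult_vec:
  assumes "A \<in> carrier_mat n n" "u \<in> carrier_vec n"
  shows "A ^\<^sub>m Suc k *\<^sub>v u = A *\<^sub>v (A ^\<^sub>m k *\<^sub>v u)"
proof -
  have "A ^\<^sub>m Suc k = A * A ^\<^sub>m k"
    using assms(1) by (induction k) (simp_all add: assoc_mult_mat[of _ n n _ n _ n])
  with assms show ?thesis by (simp add: assoc_mult_mat_vec[of _ n n _ n])
qed

text \<open>
  By Cauchy-Schwarz the norms of the iterates \<open>A\<^sup>k u\<close> are log-convex in \<open>k\<close>, so a single expanding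
  step would make them grow geometrically, whereas spectral radius below 1 bounds all powers of \<open>A\<close>.
\<close>
lemma hermitian_contraction:
  assumes A: "A \<in> carrier_mat n n"
    and herm: "\<And>u v. u \<in> carrier_vec n \<Longrightarrow> v \<in> carrier_vec n \<Longrightarrow> (A *\<^sub>v u) \<bullet>c v = u \<bullet>c (A *\<^sub>v v)"
    and sr: "spectral_radius A < 1"
    and u: "u \<in> carrier_vec n"
  shows "norm2 (A *\<^sub>v u) \<le> norm2 u"
proof (rule ccontr)
  assume "\<not> ?thesis"
  then have gt: "norm2 u < norm2 (A *\<^sub>v u)" by simp
  define b where "b k = norm2 (A ^\<^sub>m k *\<^sub>v u)" for k
  have w: "A ^\<^sub>m k *\<^sub>v u \<in> carrier_vec n" for k
    using mult_mat_vec_carrier[OF pow_carrier_mat[OF A] u] .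
  have logconvex: "(b (Suc k))\<^sup>2 \<le> b k * b (Suc (Suc k))" for k
  proof -
    let ?w = "\<lambda>k. A ^\<^sub>m k *\<^sub>v u"
    have "complex_of_real ((b (Suc k))\<^sup>2) = (A *\<^sub>v ?w k) \<bullet>c ?w (Suc k)"
      unfolding b_def cscalar_prod_self[symmetric] pow_mat_Suc_mult_vec[OF A u] ..
    also have "\<dots> = ?w k \<bullet>c ?w (Suc (Suc k))"
      unfolding herm[OF w w] pow_mat_Suc_mult_vec[OF A u, of "Suc k"] ..
    finally have "(b (Suc k))\<^sup>2 = cmod (?w k \<bullet>c ?w (Suc (Suc k)))"
      by (metis abs_of_nonneg norm_of_real zero_le_power2)
    also have "\<dots> \<le> b k * b (Suc (Suc k))"
      using norm2_Cauchy_Schwarz[of "?w k" "conjugate (?w (Suc (Suc k)))"] A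
      by (simp add: b_def)
    finally show ?thesis .
  qed
  have b0: "b 0 = norm2 u" and b1: "b 1 = norm2 (A *\<^sub>v u)" using A u by (simp_all add: b_def)
  \<comment> \<open>If \<open>b 0\<close> vanished, log-convexity would force
    \<open>b 1 = 0\<close>, against \<open>b 0 < b 1\<close>.\<close>
  have "b 0 \<noteq> 0" using logconvex[of 0] gt b0 b1 by auto
  then have "b 0 > 0" using b0 norm2_nonneg[of u] by linarith
  define r where "r = b 1 / b 0"
  have r: "r > 1" using gt b0 b1 \<open>b 0 > 0\<close> by (simp add: r_def)
  \<comment> \<open>Log-convexity says that the ratios \<open>b (Suc k) / b k\<close> do not
    decrease, so the first ratio \<open>r\<close> is a lower bound for all. Positivity is carried
    along to cancel \<open>b k\<close>.\<close>
  have step: "b k > 0 \<and> r * b k \<le> b (Suc k)" for k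
  proof (induction k)
    case 0
    then show ?case using \<open>b 0 > 0\<close> by (simp add: r_def)
  next
    case (Suc k)
    then have pos: "b k > 0" and le: "r * b k \<le> b (Suc k)" by auto
    have pos': "b (Suc k) > 0" using pos le r by (smt (verit) mult_pos_pos)
    have "b k * (r * b (Suc k)) \<le> b (Suc k) * b (Suc k)"
      using mult_right_mono[OF le, of "b (Suc k)"] pos' by (simp add: mult_ac)
    also have "\<dots> \<le> b k * b (Suc (Suc k))" using logconvex[of k] by (simp add: power2_eq_square)
    finally show ?case using pos pos' by simp
  qed
  have growth: "r ^ k * b 0 \<le> b k" for k
  proof (induction k)
    case (Suc k)
    then have "r * (r ^ k * b 0) \<le> r * b k" using r by simp
    with step[of k] show ?case by (simp add: mult_ac)
  qed simp
  obtain c where c: "\<And>k. norm_bound (A ^\<^sub>m k) c"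
    using spectral_radius_jnf_norm_bound_less_1_upper_triangular[OF A sr] by blast
  \<comment> \<open>The entries of all powers share the bound \<open>c\<close>, so \<open>C\<close>
    bounds the sum of the moduli of an iterate, which dominates its Euclidean norm, independently of
    \<open>k\<close>.\<close>
  define C where "C = (\<Sum>i<n. \<Sum>j<n. c * cmod (u $ j))"
  have "b k \<le> C" for k
  proof -
    have "b k \<le> (\<Sum>i<n. cmod ((A ^\<^sub>m k *\<^sub>v u) $ i))"
      using L2_set_le_sum_abs[of "\<lambda>i. cmod ((A ^\<^sub>m k *\<^sub>v u) $ i)" "{..<n}"] carrier_vecD[OF w[of k]]
      by (simp add: b_def norm2_def del: dim_mult_mat_vec index_mult_mat_vec)
    also have "\<dots> \<le> C" unfolding C_def
    proof (rule sum_mono)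
      fix i assume "i \<in> {..<n}"
      then have i: "i < n" by simp
      have "cmod ((A ^\<^sub>m k *\<^sub>v u) $ i) = cmod (\<Sum>j<n. (A ^\<^sub>m k) $$ (i, j) * u $ j)"
        using i A u pow_carrier_mat[OF A, of k] by (simp add: scalar_prod_def atLeast0LessThan)
      also have "\<dots> \<le> (\<Sum>j<n. cmod ((A ^\<^sub>m k) $$ (i, j)) * cmod (u $ j))"
        by (rule order_trans[OF norm_sum]) (simp add: norm_mult)
      also have "\<dots> \<le> (\<Sum>j<n. c * cmod (u $ j))"
        using c[of k] i carrier_matD[OF pow_carrier_mat[OF A, of k]]
        by (intro sum_mono mult_right_mono) (auto simp: norm_bound_def simp del: pow_mat_dim)
      finally show "cmod ((A ^\<^sub>m k *\<^sub>v u) $ i) \<le> (\<Sum>j<n. c * cmod (u $ j))" .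
    qed
    finally show ?thesis .
  qed
  moreover obtain k where "C / b 0 < r ^ k" using real_arch_pow[OF r] by blast
  then have "C < r ^ k * b 0" using \<open>b 0 > 0\<close> by (simp add: divide_less_eq)
  ultimately show False using growth[of k] by (smt (verit))
qed

section \<open>Norm bounds and singular values\<close>

lemma gram_hermitian:
  fixes M :: "complex mat"
  assumes M: "M \<in> carrier_mat n n" and v: "v \<in> carrier_vec n" and w: "w \<in> carrier_vec n"
  shows "((mat_adjoint M * M) *\<^sub>v v) \<bullet>c w = v \<bullet>c ((mat_adjoint M * M) *\<^sub>v w)"
  using cscalar_prod_gram[OF M v w] cscalar_prod_adjoint[OF M v, of "M *\<^sub>v w"] M w
    mat_adjoint_carrier[OF M] by (simp add: assoc_mult_mat_vec[of _ n n _ n])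

text \<open>Pairing the eigenvector equation with \<open>v\<close> gives
  \<open>(norm2 (M *\<^sub>v v))\<^sup>2 = e * (norm2 v)\<^sup>2\<close>. In particular
  \<open>e\<close> is real and nonnegative, so \<open>sqrt (Re e)\<close> in
  \<open>singular_values\<close> loses no information.\<close>

lemma eigenvalue_gram:
  assumes M: "M \<in> carrier_mat n n" and ev: "eigenvector (mat_adjoint M * M) v e"
  shows "v \<in> carrier_vec n" "norm2 v > 0" "e = complex_of_real ((norm2 (M *\<^sub>v v) / norm2 v)\<^sup>2)"
proof -
  let ?A = "mat_adjoint M * M"
  note A = gram_carrier[OF M]
  from ev A have v: "v \<in> carrier_vec n" "v \<noteq> 0\<^sub>v n" "?A *\<^sub>v v = e \<cdot>\<^sub>v v"
    by (auto simp: eigenvector_def)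
  show "v \<in> carrier_vec n" by fact
  show pos: "norm2 v > 0" using v norm2_eq_0_iff[OF v(1)] norm2_nonneg[of v] by linarith
  have "complex_of_real ((norm2 (M *\<^sub>v v))\<^sup>2) = (e \<cdot>\<^sub>v v) \<bullet>c v"
    using cscalar_prod_gram[OF M v(1) v(1)] v(3) by (simp add: cscalar_prod_self)
  also have "\<dots> = e * complex_of_real ((norm2 v)\<^sup>2)"
    using v(1) by (simp add: cscalar_prod_self[symmetric] del: of_real_power)
  finally show "e = complex_of_real ((norm2 (M *\<^sub>v v) / norm2 v)\<^sup>2)"
    using pos by (simp add: power_divide)
qed

lemma mset_singular_values:
  "mset (singular_values M) = image_mset (\<lambda>e. sqrt (Re e)) (proots (char_poly (mat_adjoint M * M)))"
  by (simp add: singular_values_def)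

lemma singular_values_antimono:
  "i \<le> j \<Longrightarrow> j < length (singular_values M) \<Longrightarrow> singular_values M ! j \<le> singular_values M ! i"
  by (rule sorted_rev_nth_mono) (simp_all add: singular_values_def)

text \<open>Exhibiting a singular value as the stretching factor at an eigenvector turns operator
  norm bounds into bounds on singular values.\<close>

lemma singular_valuesE:
  assumes M: "M \<in> carrier_mat n n" and s: "s \<in> set (singular_values M)"
  obtains v where "v \<in> carrier_vec n" "norm2 v > 0" "s = norm2 (M *\<^sub>v v) / norm2 v"
proof -
  let ?A = "mat_adjoint M * M"
  note A = gram_carrier[OF M]
  have "s \<in># mset (singular_values M)" using s by simp
  then obtain e where e: "e \<in># proots (char_poly ?A)" "s = sqrt (Re e)"
    unfolding mset_singular_values by auto
  have "char_poly ?A \<noteq> 0" using degree_monic_char_poly[OF A] by auto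
  with e(1) have "poly (char_poly ?A) e = 0" by simp
  then obtain v where v: "eigenvector ?A v e"
    using eigenvalue_root_char_poly[OF A] by (auto simp: eigenvalue_def)
  note g = eigenvalue_gram[OF M v]
  have "s = norm2 (M *\<^sub>v v) / norm2 v" using e(2) g(2) by (subst (asm) g(3)) simp
  with g that show ?thesis by blast
qed

lemma singular_values_le:
  assumes M: "M \<in> carrier_mat n n" and l: "l < n"
    and bound: "\<And>u. u \<in> carrier_vec n \<Longrightarrow> norm2 (M *\<^sub>v u) \<le> c * norm2 u"
  shows "singular_values M ! l \<le> c"
proof -
  have "singular_values M ! l \<in> set (singular_values M)"
    using l length_singular_values[OF M] by simp
  from singular_valuesE[OF M this] obtain v where "v \<in> carrier_vec n" "norm2 v > 0"
    "singular_values M ! l = norm2 (M *\<^sub>v v) / norm2 v" .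
  with bound[of v] show ?thesis by (simp add: divide_le_eq)
qed

lemma eigenvalue_gram_in_singular_values:
  assumes M: "M \<in> carrier_mat n n" and e: "eigenvalue (mat_adjoint M * M) e"
  obtains s where "s \<in> set (singular_values M)" "s \<ge> 0" "e = complex_of_real (s\<^sup>2)"
proof -
  let ?A = "mat_adjoint M * M"
  note A = gram_carrier[OF M]
  from e obtain v where v: "eigenvector ?A v e" by (auto simp: eigenvalue_def)
  let ?s = "norm2 (M *\<^sub>v v) / norm2 v"
  note es = eigenvalue_gram(3)[OF M v]
  have "char_poly ?A \<noteq> 0" using degree_monic_char_poly[OF A] by auto
  then have "e \<in># proots (char_poly ?A)" using e eigenvalue_root_char_poly[OF A] by simp
  then have "sqrt (Re e) \<in># mset (singular_values M)" unfolding mset_singular_values by simp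
  moreover have "sqrt (Re e) = ?s" by (subst es) simp
  ultimately show ?thesis using that[of ?s] es by simp
qed

text \<open>No diagonalisation is used: for every \<open>t\<close> above the square of the largest
  singular value, the Gram matrix divided by \<open>t\<close> has spectral radius below 1 and is a
  contraction. The claim follows as \<open>t\<close> decreases to that square.\<close>

lemma norm2_mult_le_largest_singular_value:
  assumes M: "M \<in> carrier_mat n n" and n: "n > 0" and u: "u \<in> carrier_vec n"
  shows "norm2 (M *\<^sub>v u) \<le> singular_values M ! 0 * norm2 u"
proof -
  let ?A = "mat_adjoint M * M"
  define L where "L = singular_values M ! 0"
  note A = gram_carrier[OF M]
  have "L \<in> set (singular_values M)" using n length_singular_values[OF M] by (simp add: L_def)
  from singular_valuesE[OF M this] have L0: "L \<ge> 0" by (metis divide_nonneg_nonneg norm2_nonneg)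
  have L: "s \<le> L" if "s \<in> set (singular_values M)" for s
    using that singular_values_antimono[of 0 _ M] by (auto simp: in_set_conv_nth L_def)
  have step: "(norm2 (M *\<^sub>v u))\<^sup>2 \<le> t * (norm2 u)\<^sup>2" if t: "L\<^sup>2 < t" for t
  proof -
    have tpos: "t > 0" using t zero_le_power2[of L] by linarith
    define B where "B = complex_of_real (1 / t) \<cdot>\<^sub>m ?A"
    have B: "B \<in> carrier_mat n n" using A by (simp add: B_def)
    have Bv: "B *\<^sub>v v = complex_of_real (1 / t) \<cdot>\<^sub>v (?A *\<^sub>v v)" if "v \<in> carrier_vec n" for v
      unfolding B_def using A that by (intro eq_vecI) auto
    have Av: "?A *\<^sub>v v = complex_of_real t \<cdot>\<^sub>v (B *\<^sub>v v)" if "v \<in> carrier_vec n" for v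
      using tpos by (simp add: Bv[OF that] smult_smult_assoc)
    \<comment> \<open>Scaling divides the eigenvalues by \<open>t\<close>, and those of
      \<open>?A\<close> are squares of singular values, hence at most
      \<open>L\<^sup>2 < t\<close>.\<close>
    have "cmod e < 1" if "e \<in> spectrum B" for e
    proof -
      from that obtain v where v: "eigenvector B v e" by (auto simp: spectrum_def eigenvalue_def)
      then have "eigenvector ?A v (complex_of_real t * e)"
        using B A Av[of v] by (auto simp: eigenvector_def smult_smult_assoc)
      then have "eigenvalue ?A (complex_of_real t * e)" by (auto simp: eigenvalue_def)
      from eigenvalue_gram_in_singular_values[OF M this] obtain s where
        s: "s \<in> set (singular_values M)" "s \<ge> 0" "complex_of_real t * e = complex_of_real (s\<^sup>2)" .
      have "t * cmod e = s\<^sup>2"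
        using arg_cong[OF s(3), of cmod] tpos by (simp add: norm_mult norm_power)
      also have "\<dots> \<le> L\<^sup>2" using L[OF s(1)] s(2) by (simp add: power_mono)
      also have "\<dots> < t" by fact
      finally show ?thesis using tpos by simp
    qed
    then have "spectral_radius B < 1" using spectral_radius_mem_max(1)[OF B n] by auto
    moreover have "(B *\<^sub>v v) \<bullet>c w = v \<bullet>c (B *\<^sub>v w)"
      if v: "v \<in> carrier_vec n" and w: "w \<in> carrier_vec n" for v w
    proof -
      show ?thesis
        using gram_hermitian[OF M v w] v w mult_mat_vec_carrier[OF A v] mult_mat_vec_carrier[OF A w]
        by (simp add: Bv conjugate_smult_vec smult_scalar_prod_distrib[of _ n]
            scalar_prod_smult_distrib[of _ n])
    qed
    ultimately have "norm2 (B *\<^sub>v u) \<le> norm2 u" using hermitian_contraction[OF B _ _ u] by blast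
    then have Au: "norm2 (?A *\<^sub>v u) \<le> t * norm2 u"
      using tpos by (simp add: Av[OF u] norm2_smult)
    have "(norm2 (M *\<^sub>v u))\<^sup>2 = cmod ((?A *\<^sub>v u) \<bullet>c u)"
      by (simp add: cscalar_prod_gram[OF M u u] cscalar_prod_self norm_power)
    also have "\<dots> \<le> norm2 (?A *\<^sub>v u) * norm2 u"
      using norm2_Cauchy_Schwarz[of "?A *\<^sub>v u" "conjugate u"] carrier_matD(1)[OF A] u by simp
    also have "\<dots> \<le> t * norm2 u * norm2 u" using Au by (simp add: mult_right_mono)
    finally show ?thesis by (simp add: power2_eq_square mult_ac)
  qed
  have "(norm2 (M *\<^sub>v u))\<^sup>2 \<le> L\<^sup>2 * (norm2 u)\<^sup>2"
  proof (cases "norm2 u = 0")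
    case True
    then show ?thesis using step[of "L\<^sup>2 + 1"] by simp
  next
    case False
    then have pos: "(norm2 u)\<^sup>2 > 0" by simp
    have "(norm2 (M *\<^sub>v u))\<^sup>2 / (norm2 u)\<^sup>2 \<le> L\<^sup>2"
    proof (rule dense_ge)
      fix t assume "L\<^sup>2 < t"
      from step[OF this] show "(norm2 (M *\<^sub>v u))\<^sup>2 / (norm2 u)\<^sup>2 \<le> t"
        unfolding pos_divide_le_eq[OF pos] .
    qed
    then show ?thesis unfolding pos_divide_le_eq[OF pos] .
  qed
  then have "(norm2 (M *\<^sub>v u))\<^sup>2 \<le> (L * norm2 u)\<^sup>2" by (simp add: power_mult_distrib)
  then show ?thesis unfolding L_def[symmetric] by (rule power2_le_imp_le) (simp add: L0)
qed

text \<open>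
  The first two columns of a Schur basis whose diagonal starts with \<open>e1, e2\<close> span an invariant plane,
  and orthogonalising them yields eigenvectors; this also covers a double root \<open>e1 = e2\<close>.
\<close>
lemma two_orthogonal_eigenvectors:
  fixes A :: "complex mat"
  assumes A: "A \<in> carrier_mat n n"
    and herm: "\<And>u v. u \<in> carrier_vec n \<Longrightarrow> v \<in> carrier_vec n \<Longrightarrow> (A *\<^sub>v u) \<bullet>c v = u \<bullet>c (A *\<^sub>v v)"
    and roots: "proots (char_poly A) = add_mset e1 (add_mset e2 X)"
  obtains p q where "p \<in> carrier_vec n" "q \<in> carrier_vec n" "p \<noteq> 0\<^sub>v n" "q \<noteq> 0\<^sub>v n"
    "q \<bullet>c p = 0" "A *\<^sub>v p = e1 \<cdot>\<^sub>v p" "A *\<^sub>v q = e2 \<cdot>\<^sub>v q"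
proof -
  obtain xs where xs: "mset xs = X" using ex_mset by blast
  have monic: "lead_coeff (char_poly A) = 1" "degree (char_poly A) = n"
    using degree_monic_char_poly[OF A] by auto
  have "char_poly A = (\<Prod>e\<in>#proots (char_poly A). [:- e, 1:])"
    using complex_poly_decompose_multiset[of "char_poly A"] monic by simp
  also have "\<dots> = (\<Prod>e\<leftarrow>e1 # e2 # xs. [:- e, 1:])"
    unfolding roots xs[symmetric] by (simp flip: prod_mset_prod_list)
  finally have cp: "char_poly A = (\<Prod>e\<leftarrow>e1 # e2 # xs. [:- e, 1:])" .
  have n: "n > 1"
    using size_proots_complex[of "char_poly A"] unfolding roots monic by simp
  \<comment> \<open>The triangular factor lists the eigenvalues on its diagonal in the order
    supplied, so \<open>e1\<close> and \<open>e2\<close> come first.\<close>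
  obtain B P Q where "schur_decomposition A (e1 # e2 # xs) = (B, P, Q)"
    by (cases "schur_decomposition A (e1 # e2 # xs)")
  from schur_decomposition[OF A cp this] have wit: "similar_mat_wit A B P Q"
    and ut: "upper_triangular B" and diag: "diag_mat B = e1 # e2 # xs" by auto
  from similar_mat_witD2[OF A wit] have QP: "Q * P = 1\<^sub>m n" and APBQ: "A = P * B * Q"
    and B: "B \<in> carrier_mat n n" and P: "P \<in> carrier_mat n n" and Q: "Q \<in> carrier_mat n n" by auto
  have AP: "A * P = P * B"
    unfolding APBQ using B P Q QP by (simp add: assoc_mult_mat[of _ n n _ n _ n])
  define p r where "p = col P 0" and "r = col P 1"
  have p: "p \<in> carrier_vec n" and r: "r \<in> carrier_vec n" using P n by (auto simp: p_def r_def)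
  have Bdiag: "B $$ (0, 0) = e1" "B $$ (1, 1) = e2"
    using B n arg_cong[OF diag, of "\<lambda>xs. xs ! 0"] arg_cong[OF diag, of "\<lambda>xs. xs ! 1"]
    by (simp_all add: diag_mat_def)
  have Bzero: "B $$ (i, j) = 0" if "j < i" "i < n" for i j
    using ut B that by (auto simp: upper_triangular_def)
  \<comment> \<open>The only entry above the diagonal in the second column: it measures how far
    \<open>r\<close> is from being an eigenvector.\<close>
  define \<beta> where "\<beta> = B $$ (0, 1)"
  have col_AP: "A *\<^sub>v col P j = P *\<^sub>v col B j" if "j < n" for j
    unfolding col_mult2[OF A P that, symmetric] col_mult2[OF P B that, symmetric] AP ..
  have P_unit: "P *\<^sub>v unit_vec n j = col P j" if "j < n" for j
    using P that by (intro eq_vecI) auto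
  have Ap: "A *\<^sub>v p = e1 \<cdot>\<^sub>v p"
  proof -
    have "col B 0 = e1 \<cdot>\<^sub>v unit_vec n 0"
      using B n Bzero Bdiag by (intro eq_vecI) (auto simp: unit_vec_def)
    then show ?thesis using col_AP[of 0] P n
      by (simp add: p_def mult_mat_vec[of _ n n] P_unit)
  qed
  have Ar: "A *\<^sub>v r = \<beta> \<cdot>\<^sub>v p + e2 \<cdot>\<^sub>v r"
  proof -
    have "col B 1 = \<beta> \<cdot>\<^sub>v unit_vec n 0 + e2 \<cdot>\<^sub>v unit_vec n 1"
      using B n Bzero Bdiag by (intro eq_vecI) (auto simp: unit_vec_def \<beta>_def)
    then show ?thesis using col_AP[of 1] P n
      by (simp add: p_def r_def mult_mat_vec[of _ n n] mult_add_distrib_mat_vec[of _ n n] P_unit)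
  qed
  \<comment> \<open>\<open>Q\<close> sends the columns of \<open>P\<close> back to unit vectors,
    which shows below that \<open>p\<close> and \<open>q\<close> are nonzero.\<close>
  have Q_col: "Q *\<^sub>v col P j = unit_vec n j" if "j < n" for j
    unfolding col_mult2[OF Q P that, symmetric] QP using that by simp
  have p0: "p \<noteq> 0\<^sub>v n"
  proof
    assume "p = 0\<^sub>v n"
    then have "Q *\<^sub>v p = 0\<^sub>v n" using Q by (intro eq_vecI) auto
    then show False using Q_col[of 0] n by (simp add: p_def)
  qed
  \<comment> \<open>The Gram-Schmidt coefficient: \<open>q\<close> is \<open>r\<close> minus its
    projection onto \<open>p\<close>.\<close>
  define c where "c = - ((r \<bullet>c p) / (p \<bullet>c p))"
  define q where "q = c \<cdot>\<^sub>v p + r"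
  have q: "q \<in> carrier_vec n" using p r by (simp add: q_def)
  have q0: "q \<noteq> 0\<^sub>v n"
  proof
    assume "q = 0\<^sub>v n"
    then have "Q *\<^sub>v q = 0\<^sub>v n" using Q by (intro eq_vecI) auto
    moreover have "Q *\<^sub>v q = c \<cdot>\<^sub>v unit_vec n 0 + unit_vec n 1"
      using Q p r n Q_col[of 0] Q_col[of 1]
      by (simp add: q_def mult_mat_vec[of _ n n] mult_add_distrib_mat_vec[of _ n n] p_def r_def)
    ultimately have "(c \<cdot>\<^sub>v unit_vec n 0 + unit_vec n 1) $ 1 = (0\<^sub>v n :: complex vec) $ 1" by simp
    then show False using n by simp
  qed
  have pp: "p \<bullet>c p \<noteq> 0" using p p0 by simp
  have qp: "q \<bullet>c p = 0"
    using p r pp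
    by (simp add: q_def c_def add_scalar_prod_distrib[of _ n] smult_scalar_prod_distrib[of _ n])
  define \<gamma> where "\<gamma> = c * e1 + \<beta> - e2 * c"
  have Aq: "A *\<^sub>v q = \<gamma> \<cdot>\<^sub>v p + e2 \<cdot>\<^sub>v q"
  proof -
    have "A *\<^sub>v q = c \<cdot>\<^sub>v (e1 \<cdot>\<^sub>v p) + (\<beta> \<cdot>\<^sub>v p + e2 \<cdot>\<^sub>v r)"
      using A p r by (simp add: q_def mult_mat_vec[of _ n n] mult_add_distrib_mat_vec[of _ n n] Ap Ar)
    also have "\<dots> = \<gamma> \<cdot>\<^sub>v p + e2 \<cdot>\<^sub>v q"
      using p r by (intro eq_vecI) (auto simp: q_def \<gamma>_def algebra_simps)
    finally show ?thesis .
  qed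
  \<comment> \<open>Moving \<open>A\<close> to the other side leaves a multiple of
    \<open>q \<bullet>c p\<close>, which is 0; so the component \<open>\<gamma>\<close> of
    \<open>A *\<^sub>v q\<close> along \<open>p\<close> vanishes.\<close>
  have "(A *\<^sub>v q) \<bullet>c p = 0"
    using herm[OF q p] Ap p q qp by (simp add: conjugate_smult_vec scalar_prod_smult_distrib[of _ n])
  moreover have "(A *\<^sub>v q) \<bullet>c p = \<gamma> * (p \<bullet>c p)"
    using p q qp by (simp add: Aq add_scalar_prod_distrib[of _ n] smult_scalar_prod_distrib[of _ n])
  ultimately have "\<gamma> = 0" using pp by simp
  then have "A *\<^sub>v q = e2 \<cdot>\<^sub>v q" using Aq p q by auto
  with that p q p0 q0 qp Ap show ?thesis by blast
qed

text \<open>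
  If two singular values exceeded \<open>c\<close>, the plane spanned by their eigenvectors would meet the
  hyperplane in a nonzero vector violating the bound.
\<close>
lemma singular_values_le_of_hyperplane:
  assumes M: "M \<in> carrier_mat n n" and l: "0 < l" "l < n" and c: "c \<ge> 0"
    and w: "w \<in> carrier_vec n"
    and bound: "\<And>u. u \<in> carrier_vec n \<Longrightarrow> w \<bullet> u = 0 \<Longrightarrow> norm2 (M *\<^sub>v u) \<le> c * norm2 u"
  shows "singular_values M ! l \<le> c"
proof (rule ccontr)
  assume neg: "\<not> ?thesis"
  let ?A = "mat_adjoint M * M" and ?sv = "singular_values M"
  note A = gram_carrier[OF M]
  have len: "length ?sv = n" by (rule length_singular_values[OF M])
  have gt: "?sv ! 0 > c" "?sv ! l > c"
    using neg singular_values_antimono[of 0 l M] l len by auto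
  \<comment> \<open>Separating the head from the tail secures two occurrences in the multiset even
    if the two values coincide; they are then lifted to two roots counted with multiplicity.\<close>
  obtain s ss where sv: "?sv = s # ss" using len l by (cases ?sv) auto
  then have s: "s > c" and "ss ! (l - 1) > c" "ss ! (l - 1) \<in> set ss" using gt l len by auto
  then obtain s' where s': "s' > c" "s' \<in> set ss" by blast
  then obtain Y where "mset ss = add_mset s' Y" by (metis insert_DiffM set_mset_mset)
  with sv have "image_mset (\<lambda>e. sqrt (Re e)) (proots (char_poly ?A)) = add_mset s (add_mset s' Y)"
    using mset_singular_values[of M] by simp
  from msed_map_invR[OF this] obtain e1 X1 where e1: "proots (char_poly ?A) = add_mset e1 X1"
    "sqrt (Re e1) = s" and X1: "image_mset (\<lambda>e. sqrt (Re e)) X1 = add_mset s' Y" by blast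
  from msed_map_invR[OF X1] obtain e2 X where e2: "X1 = add_mset e2 X" "sqrt (Re e2) = s'" by blast
  have big: "Re e1 > c\<^sup>2" "Re e2 > c\<^sup>2"
    using e1(2) e2(2) s s'(1) c by (metis not_less real_le_lsqrt)+
  obtain p q where p: "p \<in> carrier_vec n" "p \<noteq> 0\<^sub>v n" and q: "q \<in> carrier_vec n" "q \<noteq> 0\<^sub>v n"
    and qp: "q \<bullet>c p = 0" and Ap: "?A *\<^sub>v p = e1 \<cdot>\<^sub>v p" and Aq: "?A *\<^sub>v q = e2 \<cdot>\<^sub>v q"
    using two_orthogonal_eigenvectors[OF A gram_hermitian[OF M], of e1 e2 X] e1(1) e2(1) by metis
  have pq: "p \<bullet>c q = 0"
    using qp p q by (metis conjugate_conjugate_sprod conjugate_vec_sprod_comm conjugate_zero)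
  \<comment> \<open>One linear equation in two unknowns has a nontrivial solution.\<close>
  obtain a b where ab: "a \<noteq> 0 \<or> b \<noteq> 0" "a * (w \<bullet> p) + b * (w \<bullet> q) = 0"
  proof (cases "w \<bullet> p = 0")
    case True
    then show ?thesis using that[of 1 0] by simp
  next
    case False
    then show ?thesis using that[of "w \<bullet> q" "- (w \<bullet> p)"] by simp
  qed
  define u where "u = a \<cdot>\<^sub>v p + b \<cdot>\<^sub>v q"
  have u: "u \<in> carrier_vec n" using p q by (simp add: u_def)
  have "w \<bullet> u = 0" using ab(2) p q w
    by (simp add: u_def scalar_prod_add_distrib[of _ n] scalar_prod_smult_distrib[of _ n])
  \<comment> \<open>The squared lengths of the components of \<open>u\<close> along \<open>p\<close>
    and \<open>q\<close>. Orthogonality removes the cross terms, so the squared norm of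
    \<open>u\<close> is \<open>x + y\<close>, and that of its image weights \<open>x\<close> and
    \<open>y\<close> by the two eigenvalues.\<close>
  define x y where "x = (cmod a * norm2 p)\<^sup>2" and "y = (cmod b * norm2 q)\<^sup>2"
  have form: "(\<alpha> \<cdot>\<^sub>v p + \<beta> \<cdot>\<^sub>v q) \<bullet>c u =
      \<alpha> * cnj a * complex_of_real ((norm2 p)\<^sup>2) + \<beta> * cnj b * complex_of_real ((norm2 q)\<^sup>2)" for \<alpha> \<beta>
    using p q pq qp
    by (simp add: u_def conjugate_add_vec[of _ n] conjugate_smult_vec add_scalar_prod_distrib[of _ n]
        scalar_prod_add_distrib[of _ n] smult_scalar_prod_distrib[of _ n]
        scalar_prod_smult_distrib[of _ n] cscalar_prod_self[symmetric] del: of_real_power)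
  have aa: "z * cnj z * complex_of_real t = complex_of_real ((cmod z)\<^sup>2 * t)" for z t
    by (simp only: of_real_mult complex_norm_square)
  have "complex_of_real ((norm2 u)\<^sup>2) = complex_of_real (x + y)"
    unfolding cscalar_prod_self[symmetric] using form[of a b, folded u_def]
    by (simp only: aa x_def y_def power_mult_distrib of_real_add)
  then have nu: "(norm2 u)\<^sup>2 = x + y" by (simp only: of_real_eq_iff)
  have Au: "?A *\<^sub>v u = (e1 * a) \<cdot>\<^sub>v p + (e2 * b) \<cdot>\<^sub>v q"
    using A p q by (simp add: u_def mult_mat_vec[of _ n n] mult_add_distrib_mat_vec[of _ n n] Ap Aq
        smult_smult_assoc mult.commute)
  have "complex_of_real ((norm2 (M *\<^sub>v u))\<^sup>2) = (?A *\<^sub>v u) \<bullet>c u"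
    by (simp only: cscalar_prod_gram[OF M u u] cscalar_prod_self)
  also have "\<dots> = e1 * complex_of_real x + e2 * complex_of_real y"
    unfolding Au form by (simp only: mult.assoc aa[unfolded mult.assoc] x_def y_def power_mult_distrib)
  finally have "(norm2 (M *\<^sub>v u))\<^sup>2 = Re (e1 * complex_of_real x + e2 * complex_of_real y)"
    by (metis Re_complex_of_real)
  then have nMu: "(norm2 (M *\<^sub>v u))\<^sup>2 = Re e1 * x + Re e2 * y" by simp
  have xy: "x \<ge> 0" "y \<ge> 0" by (simp_all add: x_def y_def)
  \<comment> \<open>A nonzero component is what makes the next inequality strict.\<close>
  have "x > 0 \<or> y > 0"
    using ab(1) p q norm2_eq_0_iff[of p n] norm2_eq_0_iff[of q n] by (auto simp: x_def y_def)
  then have "c\<^sup>2 * x + c\<^sup>2 * y < Re e1 * x + Re e2 * y"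
    using big xy by (smt (verit) mult_right_mono mult_strict_right_mono)
  moreover have "(norm2 (M *\<^sub>v u))\<^sup>2 \<le> (c * norm2 u)\<^sup>2"
    using bound[OF u \<open>w \<bullet> u = 0\<close>] by (simp add: power_mono)
  ultimately show False using nu nMu by (simp add: power_mult_distrib algebra_simps)
qed

section \<open>Phase vectors and bins\<close>

definition phase_vec :: "nat \<Rightarrow> nat \<Rightarrow> nat \<Rightarrow> complex vec" where
  "phase_vec N n j = vec n (\<lambda>i. exp (\<i> * complex_of_real (2 * pi * real j * real i / real N)))"

lemma phase_vec_carrier [simp]: "phase_vec N n j \<in> carrier_vec n"
  by (simp add: phase_vec_def)

lemma dim_phase_vec [simp]: "dim_vec (phase_vec N n j) = n"
  by (simp add: phase_vec_def)

lemma norm2_phase_vec: "norm2 (phase_vec N n j) = sqrt (real n)"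
proof -
  have "norm2 (phase_vec N n j) = L2_set (\<lambda>i. 1) {..<n}"
    unfolding norm2_def dim_phase_vec
    by (intro L2_set_cong) (simp_all add: phase_vec_def del: of_real_divide of_real_mult)
  then show ?thesis by (simp add: L2_set_constant)
qed

lemma bin_eq_image: "bin N d k = (\<lambda>j. k + j * (N div d)) ` {..<d}"
  by (auto simp: bin_def)

lemma finite_bin [simp]: "finite (bin N d k)"
  by (simp add: bin_eq_image)

lemma card_bin_le: "card (bin N d k) \<le> d"
  unfolding bin_eq_image using card_image_le[of "{..<d}"] by (metis card_lessThan finite_lessThan)

text \<open>In the form of residue classes, the bins visibly partition the indices below
  \<open>N\<close>.\<close>

lemma bin_eq_residue_class:
  assumes "d dvd N" "k < N div d"
  shows "bin N d k = {j. j < N \<and> j mod (N div d) = k}"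
proof (intro equalityI subsetI)
  let ?m = "N div d"
  have N: "N = d * ?m" using assms(1) by simp
  fix i
  {
    assume "i \<in> bin N d k"
    then obtain j where j: "i = k + j * ?m" "j < d" by (auto simp: bin_def)
    have "i < Suc j * ?m" using j(1) assms(2) by simp
    also have "\<dots> \<le> d * ?m" using j(2) by (intro mult_right_mono) auto
    finally show "i \<in> {j. j < N \<and> j mod ?m = k}" using N j(1) assms(2) by simp
  next
    assume "i \<in> {j. j < N \<and> j mod ?m = k}"
    then have i: "i < N" "i mod ?m = k" by auto
    have "i = k + (i div ?m) * ?m" using i(2) by (metis add.commute div_mult_mod_eq)
    moreover have "i div ?m < d" using i(1) N by (metis less_mult_imp_div_less)
    ultimately show "i \<in> bin N d k" unfolding bin_def by blast
  }
qed

lemma sum_card_bin_inter: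
  assumes "0 < N" "0 < d" "d dvd N" "T \<subseteq> {..<N}"
  shows "(\<Sum>k<N div d. card (bin N d k \<inter> T)) = card T"
proof -
  have m: "N div d > 0" using assms by (auto simp: dvd_def)
  have "T = (\<Union>k<N div d. bin N d k \<inter> T)"
    using assms(4) m by (auto simp: bin_eq_residue_class[OF assms(3)])
  then have "card T = card (\<Union>k<N div d. bin N d k \<inter> T)" by simp
  also have "\<dots> = (\<Sum>k<N div d. card (bin N d k \<inter> T))"
    by (intro card_UN_disjoint) (auto simp: bin_eq_residue_class[OF assms(3)])
  finally show ?thesis by simp
qed

section \<open>Hankel matrices as sums of rank-one matrices\<close>

text \<open>The operator \<open>\<Sum> x_j v_j v_j^T\<close> applied to \<open>u\<close>, with the
  plain transpose: the pairing with \<open>u\<close> is bilinear. The index set is a parameter so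
  that a significant index can be split off from its bin.\<close>

definition rank_one_sum :: "complex vec \<Rightarrow> nat \<Rightarrow> nat set \<Rightarrow> complex vec \<Rightarrow> complex vec" where
  "rank_one_sum x n S u = vec n (\<lambda>i. \<Sum>j\<in>S.
     x $ j * (phase_vec (dim_vec x) n j \<bullet> u) * phase_vec (dim_vec x) n j $ i)"

lemma hankel_carrier [simp]: "hankel x d am k \<in> carrier_mat am am"
  by (simp add: hankel_def)

text \<open>Hankel entries depend on \<open>i + l\<close> only, and the exponential turns this sum
  into a product of a factor in \<open>i\<close> and a factor in \<open>l\<close>.\<close>

lemma hankel_mult_vec:
  assumes u: "u \<in> carrier_vec am"
  shows "hankel x d am k *\<^sub>v u = rank_one_sum x am (bin (dim_vec x) d k) u"
proof (rule eq_vecI)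
  let ?N = "dim_vec x" and ?S = "bin (dim_vec x) d k"
  let ?e = "\<lambda>j i. exp (\<i> * complex_of_real (2 * pi * real j * real i / real ?N))"
  fix i assume "i < dim_vec (rank_one_sum x am ?S u)"
  then have i: "i < am" by (simp add: rank_one_sum_def)
  have e: "?e j (i + l) = ?e j i * ?e j l" for j l
    by (simp add: exp_add[symmetric] add_divide_distrib algebra_simps)
  have "(hankel x d am k *\<^sub>v u) $ i = (\<Sum>l<am. (\<Sum>j\<in>?S. x $ j * ?e j (i + l)) * u $ l)"
    using i u by (simp add: hankel_def scalar_prod_def atLeast0LessThan syndrome_def)
  also have "\<dots> = (\<Sum>l<am. \<Sum>j\<in>?S. x $ j * (?e j l * u $ l) * ?e j i)"
    unfolding e by (subst sum_distrib_right) (simp add: mult_ac)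
  also have "\<dots> = (\<Sum>j\<in>?S. \<Sum>l<am. x $ j * (?e j l * u $ l) * ?e j i)"
    by (rule sum.swap)
  also have "\<dots> = rank_one_sum x am ?S u $ i"
    using i u by (simp add: rank_one_sum_def scalar_prod_def atLeast0LessThan phase_vec_def
        sum_distrib_left sum_distrib_right)
  finally show "(hankel x d am k *\<^sub>v u) $ i = rank_one_sum x am ?S u $ i" .
qed (simp add: rank_one_sum_def hankel_def)

text \<open>Each term contributes at most \<open>n * q * norm2 u\<close>: one factor
  \<open>sqrt n\<close> comes from Cauchy-Schwarz against the phase vector, the other from the norm
  of that vector.\<close>

lemma norm2_rank_one_sum_le:
  assumes u: "u \<in> carrier_vec n" and S: "finite S" and q: "\<And>j. j \<in> S \<Longrightarrow> cmod (x $ j) \<le> q"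
  shows "norm2 (rank_one_sum x n S u) \<le> real n * real (card S) * q * norm2 u"
proof -
  let ?v = "phase_vec (dim_vec x) n"
  have "norm2 (rank_one_sum x n S u) \<le> (\<Sum>j\<in>S. norm2 (vec n (\<lambda>i. x $ j * (?v j \<bullet> u) * ?v j $ i)))"
    unfolding rank_one_sum_def using S by (rule norm2_sum_le)
  also have "\<dots> \<le> (\<Sum>j\<in>S. real n * q * norm2 u)"
  proof (rule sum_mono)
    fix j assume j: "j \<in> S"
    have "vec n (\<lambda>i. x $ j * (?v j \<bullet> u) * ?v j $ i) = (x $ j * (?v j \<bullet> u)) \<cdot>\<^sub>v ?v j"
      by auto
    then have "norm2 (vec n (\<lambda>i. x $ j * (?v j \<bullet> u) * ?v j $ i))
        = cmod (x $ j) * cmod (?v j \<bullet> u) * sqrt (real n)"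
      by (simp add: norm2_smult norm_mult norm2_phase_vec)
    also have "\<dots> \<le> q * (sqrt (real n) * norm2 u) * sqrt (real n)"
      using q[OF j] norm2_Cauchy_Schwarz[of "?v j" u] u
      by (intro mult_right_mono mult_mono) (auto simp: norm2_phase_vec intro: order_trans[OF norm_ge_zero])
    also have "\<dots> = real n * q * norm2 u" by simp
    finally show "norm2 (vec n (\<lambda>i. x $ j * (?v j \<bullet> u) * ?v j $ i)) \<le> real n * q * norm2 u" .
  qed
  finally show ?thesis by (simp add: mult_ac)
qed

lemma rank_one_sum_remove:
  assumes "finite S" "t \<in> S"
  shows "rank_one_sum x n S u = (x $ t * (phase_vec (dim_vec x) n t \<bullet> u)) \<cdot>\<^sub>v phase_vec (dim_vec x) n t
           + rank_one_sum x n (S - {t}) u"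
  using assms by (intro eq_vecI) (auto simp: rank_one_sum_def sum.remove)

lemma hankel_singular_values_le:
  assumes "l < am" "q \<ge> 0" "\<And>j. j \<in> bin (dim_vec x) d k \<Longrightarrow> cmod (x $ j) \<le> q"
  shows "singular_values (hankel x d am k) ! l \<le> real am * real d * q"
proof (rule singular_values_le[OF hankel_carrier assms(1)])
  fix u :: "complex vec" assume u: "u \<in> carrier_vec am"
  have "norm2 (hankel x d am k *\<^sub>v u) \<le> real am * real (card (bin (dim_vec x) d k)) * q * norm2 u"
    unfolding hankel_mult_vec[OF u] using norm2_rank_one_sum_le[OF u finite_bin assms(3)] .
  also have "\<dots> \<le> real am * real d * q * norm2 u"
    using card_bin_le assms(2) by (intro mult_right_mono mult_left_mono) auto
  finally show "norm2 (hankel x d am k *\<^sub>v u) \<le> real am * real d * q * norm2 u" .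
qed

lemma hankel_other_singular_values_le:
  assumes l: "0 < l" "l < am" and q: "q \<ge> 0" and t: "t \<in> bin (dim_vec x) d k"
    and bound: "\<And>j. j \<in> bin (dim_vec x) d k - {t} \<Longrightarrow> cmod (x $ j) \<le> q"
  shows "singular_values (hankel x d am k) ! l \<le> real am * real d * q"
proof (rule singular_values_le_of_hyperplane[OF hankel_carrier l _ phase_vec_carrier])
  show "0 \<le> real am * real d * q" using q by simp
  let ?S = "bin (dim_vec x) d k" and ?v = "phase_vec (dim_vec x) am t"
  fix u :: "complex vec" assume u: "u \<in> carrier_vec am" and orth: "?v \<bullet> u = 0"
  \<comment> \<open>On this hyperplane the term of \<open>t\<close> vanishes, leaving only entries
    bounded by \<open>q\<close>.\<close>
  have "hankel x d am k *\<^sub>v u = rank_one_sum x am (?S - {t}) u"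
    unfolding hankel_mult_vec[OF u] rank_one_sum_remove[OF finite_bin t] orth
    by (auto simp: rank_one_sum_def)
  then have "norm2 (hankel x d am k *\<^sub>v u) \<le> real am * real (card (?S - {t})) * q * norm2 u"
    using norm2_rank_one_sum_le[OF u, of "?S - {t}" x q] bound by simp
  also have "\<dots> \<le> real am * real d * q * norm2 u"
    using card_bin_le[of "dim_vec x" d k] card_Diff1_le[of ?S t] q
    by (intro mult_right_mono mult_left_mono) auto
  finally show "norm2 (hankel x d am k *\<^sub>v u) \<le> real am * real d * q * norm2 u" .
qed

text \<open>At the conjugate phase vector the term of \<open>t\<close> has its full size
  \<open>am * cmod (x $ t) * sqrt am\<close>, while the remaining terms have norm at most
  \<open>am * d * q * sqrt am\<close>. The common factor \<open>sqrt am\<close> is the norm of the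
  test vector.\<close>

lemma hankel_largest_singular_value_ge:
  assumes am: "0 < am" and q: "q \<ge> 0" and t: "t \<in> bin (dim_vec x) d k"
    and bound: "\<And>j. j \<in> bin (dim_vec x) d k - {t} \<Longrightarrow> cmod (x $ j) \<le> q"
  shows "singular_values (hankel x d am k) ! 0 \<ge> real am * (cmod (x $ t) - real d * q)"
proof -
  let ?S = "bin (dim_vec x) d k" and ?v = "phase_vec (dim_vec x) am t"
  let ?u = "conjugate ?v" and ?H = "hankel x d am k"
  let ?E = "rank_one_sum x am (?S - {t}) ?u"
  have u: "?u \<in> carrier_vec am" by simp
  have nu: "norm2 ?u = sqrt (real am)" by (simp add: norm2_phase_vec)
  have vu: "?v \<bullet> ?u = of_nat am"
    by (simp add: cscalar_prod_self norm2_phase_vec flip: of_real_power)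
  have "norm2 ?E \<le> real am * real (card (?S - {t})) * q * norm2 ?u"
    using norm2_rank_one_sum_le[OF u, of "?S - {t}" x q] bound by simp
  also have "\<dots> \<le> real am * real d * q * norm2 ?u"
    using card_bin_le[of "dim_vec x" d k] card_Diff1_le[of ?S t] q
    by (intro mult_right_mono mult_left_mono) auto
  finally have E: "norm2 ?E \<le> real am * real d * q * norm2 ?u" .
  have Hu: "?H *\<^sub>v ?u = (x $ t * of_nat am) \<cdot>\<^sub>v ?v + ?E"
    unfolding hankel_mult_vec[OF u] rank_one_sum_remove[OF finite_bin t] vu ..
  \<comment> \<open>Solving for the main term gives the reverse triangle inequality.\<close>
  have "(x $ t * of_nat am) \<cdot>\<^sub>v ?v = ?H *\<^sub>v ?u + (- 1) \<cdot>\<^sub>v ?E"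
    unfolding Hu by (intro eq_vecI) (auto simp: rank_one_sum_def)
  then have "cmod (x $ t * of_nat am) * norm2 ?v = norm2 (?H *\<^sub>v ?u + (- 1) \<cdot>\<^sub>v ?E)"
    by (simp flip: norm2_smult)
  also have "\<dots> \<le> norm2 (?H *\<^sub>v ?u) + norm2 ?E"
    using norm2_triangle[of "?H *\<^sub>v ?u" "(- 1) \<cdot>\<^sub>v ?E"]
    by (simp add: norm2_smult rank_one_sum_def hankel_def)
  finally have "real am * (cmod (x $ t) - real d * q) * sqrt (real am) \<le> norm2 (?H *\<^sub>v ?u)"
    using E by (simp add: norm_mult norm2_phase_vec algebra_simps)
  also have "\<dots> \<le> singular_values ?H ! 0 * sqrt (real am)"
    using norm2_mult_le_largest_singular_value[OF hankel_carrier am u] unfolding nu .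
  finally show ?thesis using am by simp
qed

section \<open>Selection by threshold and collision counts\<close>

text \<open>Two different sets of the same size each contain an element missing from the other; a
  selected element not above \<open>\<tau>\<close> would then be preferred to an unselected one
  above it. Ties therefore leave no ambiguity.\<close>

lemma largest_subset_threshold:
  assumes "finite A" "card {p \<in> A. \<tau> < f p} = K"
  shows "largest_subset f K A R \<longleftrightarrow> R = {p \<in> A. \<tau> < f p}" (is "_ \<longleftrightarrow> R = ?G")
proof
  assume "largest_subset f K A R"
  then have R: "R \<subseteq> A" "card R = K" "\<And>p q. p \<in> R \<Longrightarrow> q \<in> A - R \<Longrightarrow> f q \<le> f p"
    by (auto simp: largest_subset_def)
  have fin: "finite R" "finite ?G" using R(1) assms(1) finite_subset by auto
  show "R = ?G"
  proof (rule ccontr)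
    assume "R \<noteq> ?G"
    then have "\<not> R \<subseteq> ?G" "\<not> ?G \<subseteq> R"
      using card_subset_eq[of ?G R] card_subset_eq[of R ?G] fin R(2) assms(2) by metis+
    then obtain p q where "p \<in> R" "p \<notin> ?G" "q \<in> ?G" "q \<notin> R" by blast
    then show False using R(1) R(3)[of p q] by auto
  qed
next
  assume "R = ?G"
  then show "largest_subset f K A R" using assms(2) by (auto simp: largest_subset_def)
qed

text \<open>As ties could allow several selections, correctness is stated for each of them, and
  existence keeps the statement from being vacuous.\<close>

theorem theorem5:
  fixes N K d am :: nat and x :: "complex vec" and T :: "nat set"
  assumes "N > 0" and "K > 0" and "d > 0" and "am > 0"
    and "d dvd N"
    and "x \<in> carrier_vec N"
    and "significant_set x K T"
    and "eps_min x T > 2 * real d * q_max x T"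
    and "\<forall>k < N div d. card (bin N d k \<inter> T) \<le> 1"
  shows "(\<exists>R. selection x d am K R) \<and>
         (\<forall>R. selection x d am K R \<longrightarrow>
            (\<forall>k < N div d. estimated_collisions R k = card (bin N d k \<inter> T)))"
proof -
  have dim: "dim_vec x = N" using assms(6) by simp
  define q where "q = q_max x T"
  define a where "a k = card (bin N d k \<inter> T)" for k
  define \<tau> where "\<tau> = real am * real d * q"
  define G where "G = {p \<in> {..<N div d} \<times> {..<am}. \<tau> < labeled_singular_value x d am p}"
  have T: "T \<subseteq> {..<N}" "card T = K"
    using assms(7) by (auto simp: significant_set_def largest_subset_def dim)
  then have finT: "finite T" using finite_subset by blast
  have q_ge: "cmod (x $ j) \<le> q" if "j < N" "j \<notin> T" for j
  proof -
    have "{..<N} - T \<noteq> {}" using that by blast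
    then show ?thesis unfolding q_def q_max_def dim using that by (auto intro!: Max_ge)
  qed
  have q0: "q \<ge> 0"
  \<comment> \<open>With every index significant, \<open>q\<close> is 0 by the convention in
    \<open>q_max\<close>.\<close>
  proof (cases "{..<N} - T = {}")
    case True
    then show ?thesis by (simp add: q_def q_max_def dim)
  next
    case False
    then obtain j where "j < N" "j \<notin> T" by blast
    from order_trans[OF norm_ge_zero q_ge[OF this]] show ?thesis .
  qed
  have eps: "2 * real d * q < cmod (x $ t)" if "t \<in> T" for t
  proof -
    have "eps_min x T \<le> cmod (x $ t)" unfolding eps_min_def using that finT by (intro Min_le) auto
    with assms(8) show ?thesis by (simp add: q_def)
  qed
  have bin_N: "j < N" if "j \<in> bin N d k" "k < N div d" for j k
    using that bin_eq_residue_class[OF assms(5)] by auto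
  \<comment> \<open>The threshold \<open>\<tau>\<close> separates exactly the leading singular
    values of the occupied bins from all others.\<close>
  have big: "\<tau> < labeled_singular_value x d am (k, l) \<longleftrightarrow> a k = 1 \<and> l = 0"
    if k: "k < N div d" and l: "l < am" for k l
  proof (cases "a k = 1")
    case False
    then have "a k = 0" using assms(9) k by (metis a_def le_eq_less_or_eq less_one)
    then have "bin N d k \<inter> T = {}" by (simp add: a_def)
    then have "singular_values (hankel x d am k) ! l \<le> \<tau>" unfolding \<tau>_def
      using hankel_singular_values_le[OF l q0, of x d k] q_ge bin_N[OF _ k] by (auto simp: dim)
    then show ?thesis using False by (simp add: labeled_singular_value_def)
  next
    case True
    then obtain t where t: "bin N d k \<inter> T = {t}" by (auto simp: a_def card_1_singleton_iff)
    then have tb: "t \<in> bin (dim_vec x) d k" "t \<in> T" by (auto simp: dim)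
    have rest: "cmod (x $ j) \<le> q" if "j \<in> bin (dim_vec x) d k - {t}" for j
      using that t q_ge bin_N[OF _ k] by (auto simp: dim)
    show ?thesis
    proof (cases "l = 0")
      case True
      \<comment> \<open>The factor 2 in the gap is used here: one \<open>d * q\<close> pays for the
        subtracted noise, the other for exceeding \<open>\<tau>\<close>.\<close>
      have "\<tau> < real am * (cmod (x $ t) - real d * q)"
        using eps[OF tb(2)] assms(4) by (simp add: \<tau>_def mult_ac)
      also have "\<dots> \<le> singular_values (hankel x d am k) ! 0"
        by (rule hankel_largest_singular_value_ge[OF assms(4) q0 tb(1) rest])
      finally show ?thesis using \<open>a k = 1\<close> True by (simp add: labeled_singular_value_def)
    next
      case False
      then have "singular_values (hankel x d am k) ! l \<le> \<tau>" unfolding \<tau>_def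
        using hankel_other_singular_values_le[OF _ l q0 tb(1) rest] by simp
      then show ?thesis using False by (simp add: labeled_singular_value_def)
    qed
  qed
  have G: "G = {k. k < N div d \<and> a k = 1} \<times> {0}"
    using big assms(4) by (auto simp: G_def)
  \<comment> \<open>Since every count is 0 or 1, the number of occupied bins is the sum of the
    counts, which is \<open>card T\<close> because the bins partition the indices.\<close>
  have "card G = card {k. k < N div d \<and> a k = 1}" by (simp add: G card_cartesian_product)
  also have "\<dots> = (\<Sum>k<N div d. if a k = 1 then 1 else 0)"
    by (simp add: sum.If_cases Int_def)
  also have "\<dots> = (\<Sum>k<N div d. a k)"
  proof (rule sum.cong[OF refl])
    fix k assume "k \<in> {..<N div d}"
    then have "a k \<le> 1" using assms(9) by (simp add: a_def)
    then show "(if a k = 1 then 1 else 0) = a k" by auto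
  qed
  also have "\<dots> = K"
    using sum_card_bin_inter[OF assms(1,3,5) T(1)] T(2) by (simp add: a_def)
  finally have "card G = K" .
  then have sel: "selection x d am K R \<longleftrightarrow> R = G" for R
    unfolding selection_def dim G_def by (intro largest_subset_threshold) (simp_all add: G_def)
  have "estimated_collisions G k = a k" if "k < N div d" for k
  proof -
    have "{p \<in> G. fst p = k} = (if a k = 1 then {(k, 0)} else {})" using that by (auto simp: G)
    moreover have "a k \<le> 1" using assms(9) that by (simp add: a_def)
    ultimately show ?thesis by (auto simp: estimated_collisions_def)
  qed
  then show ?thesis by (simp add: sel a_def)
qed

end
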